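(* For every integer $n\ge 15$, every integer in the interval $\left[-\binom{\lfloor(n-15)/3\rfloor}{2},\ \binom{\lfloor(n-15)/3\rfloor}{2}\right]$ is an eigenvalue of $\mathrm{Cay}(S_n,T_n)$.
   Context: $S_n$ is the symmetric group on $\{1,\dots,n\}$ and $T_n\subseteq S_n$ is the set of all transpositions. The transposition graph $\mathrm{Cay}(S_n,T_n)$ is the Cayley graph with vertex set $S_n$ in which $f,g\in S_n$ are adjacent iff $fg^{-1}\in T_n$. Its eigenvalues are the eigenvalues of its adjacency matrix. (Here $\binom{m}{2}=m(m-1)/2$, so it is $0$ for $m\in\{0,1\}$.) *)

theory Defs
  imports
    "HOL-Algebra.Sym_Groups"
    "Graph_Theory.Pair_Digraph"
    "Jordan_Normal_Form.Char_Poly"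
begin

definition transpositions :: "nat \<Rightarrow> (nat \<Rightarrow> nat) set" where
  "transpositions n =
     {transpose a b | a b. a \<in> {1..n} \<and> b \<in> {1..n} \<and> a \<noteq> b}"

text \<open>An undirected graph is represented by its symmetric set of arcs; here symmetry holds
  whenever the connection set is closed under inverses, as the set of transpositions is.\<close>

definition cayley_graph :: "('a, 'b) monoid_scheme \<Rightarrow> 'a set \<Rightarrow> 'a pair_pre_digraph" where
  "cayley_graph G T =
     \<lparr>pverts = carrier G,
      parcs = {(f, g). f \<in> carrier G \<and> g \<in> carrier G \<and> f \<otimes>\<^bsub>G\<^esub> inv\<^bsub>G\<^esub> g \<in> T}\<rparr>"

text \<open>The adjacency matrix with respect to an enumeration \<open>vs\<close> of the vertices
  (a distinct list whose set of elements is the vertex set).\<close>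

definition adjacency_mat :: "'a pair_pre_digraph \<Rightarrow> 'a list \<Rightarrow> real mat" where
  "adjacency_mat G vs =
     mat (length vs) (length vs) (\<lambda>(i, j). if (vs ! i, vs ! j) \<in> parcs G then 1 else 0)"

end

theory Submission
  imports Defs
begin

text \<open>
  Let \<open>a\<close> be the sum of the row permutations of a Young tableau of shape \<open>\<lambda>\<close>, \<open>b\<close> the signed sum of
  its column permutations, and \<open>z\<close> the sum of all transpositions. Since \<open>z\<close> is central,
  \<open>z a b = a z b\<close>, and \<open>a t b\<close> equals \<open>a b\<close>, \<open>- a b\<close> or \<open>0\<close> according as the transposition \<open>t\<close>
  preserves the rows, preserves the columns, or neither. So \<open>a b\<close> is an eigenvector of the
  transposition graph, whose eigenvalue is the content (sum of column minus row indices) of \<open>\<lambda>\<close>.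

  It remains to find partitions of \<open>n\<close> with prescribed content \<open>k\<close>. Wrapping a hook of odd size \<open>h\<close>
  around a small partition changes the content by any chosen multiple of \<open>h\<close>, within the limits
  imposed by the nesting, so it suffices that the small partition realizes all contents between
  \<open>- (h - 1) / 2\<close> and \<open>(h - 1) / 2\<close>. Taking \<open>h\<close> close to \<open>3 n / 4\<close> gives an induction for
  \<open>n \<ge> 244\<close>; smaller \<open>n\<close> are reached by the same step from a few explicit tables.
\<close>

section \<open>Transpositions and level-preserving permutations\<close>

definition transpositions_on :: "'a set \<Rightarrow> ('a \<Rightarrow> 'a) set" where
  "transpositions_on S = {transpose a b | a b. a \<in> S \<and> b \<in> S \<and> a \<noteq> b}"

text \<open>With \<open>f\<close> the row index of a tableau this is its row group, with
  \<open>f\<close> the column index its column group.\<close>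

definition level_perms :: "'a set \<Rightarrow> ('a \<Rightarrow> 'b) \<Rightarrow> ('a \<Rightarrow> 'a) set" where
  "level_perms S f = {p. p permutes S \<and> (\<forall>x\<in>S. f (p x) = f x)}"

lemma transpositions_on_permutes: "t \<in> transpositions_on S \<Longrightarrow> t permutes S"
  by (auto simp: transpositions_on_def intro: permutes_swap_id)

lemma finite_transpositions_on: "finite S \<Longrightarrow> finite (transpositions_on S)"
  by (rule finite_subset[OF _ finite_permutations[of S]])
    (auto intro: transpositions_on_permutes)

lemma transpositions_on_involutory: "t \<in> transpositions_on S \<Longrightarrow> t \<circ> t = id"
  by (auto simp: transpositions_on_def)

lemma transpositions_on_conj:
  assumes "r permutes S" "t \<in> transpositions_on S"
  shows "inv' r \<circ> t \<circ> r \<in> transpositions_on S"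
proof -
  obtain a b where ab: "a \<in> S" "b \<in> S" "a \<noteq> b" "t = transpose a b"
    using assms(2) by (auto simp: transpositions_on_def)
  have "inv' r \<circ> t \<circ> r = transpose (inv' r a) (inv' r b)"
    using permutes_inverses[OF assms(1)]
    by (auto simp: fun_eq_iff ab Transposition.transpose_def)
  moreover have "inv' r a \<in> S" "inv' r b \<in> S"
    using ab permutes_in_image[OF permutes_inv[OF assms(1)]] by auto
  moreover have "inv' r a \<noteq> inv' r b"
    using ab permutes_inverses[OF assms(1)] by metis
  ultimately show ?thesis by (auto simp: transpositions_on_def)
qed

text \<open>This is the centrality of the sum of all transpositions: conjugation only permutes its
  summands.\<close>

lemma bij_betw_transpositions_on_conj:
  assumes r: "r permutes S"
  shows "bij_betw (\<lambda>t. inv' r \<circ> t \<circ> r) (transpositions_on S) (transpositions_on S)"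
proof (rule bij_betw_byWitness[where f' = "\<lambda>t. r \<circ> t \<circ> inv' r"])
  have "r \<circ> t \<circ> inv' r \<in> transpositions_on S" if "t \<in> transpositions_on S" for t
    using transpositions_on_conj[OF permutes_inv[OF r] that] by (simp add: permutes_inv_inv[OF r])
  then show "(\<lambda>t. r \<circ> t \<circ> inv' r) ` transpositions_on S \<subseteq> transpositions_on S" by auto
qed (use r in \<open>auto simp: fun_eq_iff permutes_inverses transpositions_on_conj\<close>)

lemma finite_level_perms: "finite S \<Longrightarrow> finite (level_perms S f)"
  by (rule finite_subset[OF _ finite_permutations[of S]]) (auto simp: level_perms_def)

lemma level_perms_permutation: "finite S \<Longrightarrow> p \<in> level_perms S f \<Longrightarrow> permutation p"
  by (auto simp: level_perms_def intro: permutes_imp_permutation)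

lemma id_in_level_perms: "id \<in> level_perms S f"
  by (simp add: level_perms_def permutes_id)

lemma level_perms_comp:
  "p \<in> level_perms S f \<Longrightarrow> q \<in> level_perms S f \<Longrightarrow> p \<circ> q \<in> level_perms S f"
  by (auto simp: level_perms_def permutes_compose permutes_in_image)

lemma transpose_in_level_perms:
  "x \<in> S \<Longrightarrow> y \<in> S \<Longrightarrow> f x = f y \<Longrightarrow> transpose x y \<in> level_perms S f"
  by (auto simp: level_perms_def permutes_swap_id Transposition.transpose_def)

lemma sum_level_perms_comp_right:
  assumes "t \<in> level_perms S f" "t \<circ> t = id"
  shows "(\<Sum>r\<in>level_perms S f. h (r \<circ> t)) = (\<Sum>r\<in>level_perms S f. h r)"
  by (rule sum.reindex_bij_witness[where i = "\<lambda>r. r \<circ> t" and j = "\<lambda>r. r \<circ> t"])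
    (use assms in \<open>auto simp: comp_assoc level_perms_comp\<close>)

lemma sum_level_perms_comp_left:
  assumes "t \<in> level_perms S f" "t \<circ> t = id"
  shows "(\<Sum>r\<in>level_perms S f. h (t \<circ> r)) = (\<Sum>r\<in>level_perms S f. h r)"
  by (rule sum.reindex_bij_witness[where i = "\<lambda>r. t \<circ> r" and j = "\<lambda>r. t \<circ> r"])
    (use assms in \<open>auto simp: comp_assoc[symmetric] level_perms_comp\<close>)

section \<open>The Young symmetrizer as an eigenfunction\<close>

text \<open>A tableau is recorded through the coordinates of its entries. Of the Young shape,
  \<open>corner\<close> keeps that the box in the row of the upper entry and the column of the lower
  one is occupied; this supplies the \<open>u\<close> that makes mixed transpositions
  vanish.\<close>

locale tableau =
  fixes S :: "'a set" and row col :: "'a \<Rightarrow> nat"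
  assumes finite_S: "finite S"
    and position_inj: "\<lbrakk>x \<in> S; y \<in> S; row x = row y; col x = col y\<rbrakk> \<Longrightarrow> x = y"
    and corner: "\<lbrakk>x \<in> S; y \<in> S; row x < row y\<rbrakk> \<Longrightarrow> \<exists>u\<in>S. row u = row x \<and> col u = col y"
begin

text \<open>The coefficient of \<open>g\<close> in the group algebra element \<open>a t b\<close>, where \<open>a\<close> is the sum of the row
  permutations and \<open>b\<close> the signed sum of the column permutations; for \<open>t = id\<close> it is the Young
  symmetrizer.\<close>

definition young_coeff :: "('a \<Rightarrow> 'a) \<Rightarrow> ('a \<Rightarrow> 'a) \<Rightarrow> int" where
  "young_coeff t g =
     (\<Sum>r\<in>level_perms S row. \<Sum>c\<in>level_perms S col. if r \<circ> t \<circ> c = g then sign c else 0)"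

lemma level_perms_row_col:
  assumes "p \<in> level_perms S row" "p \<in> level_perms S col"
  shows "p = id"
proof
  fix x
  show "p x = id x"
  proof (cases "x \<in> S")
    case True
    with assms have "p x \<in> S" "row (p x) = row x" "col (p x) = col x"
      by (auto simp: level_perms_def permutes_in_image)
    with True show ?thesis using position_inj by simp
  next
    case False
    with assms show ?thesis using permutes_not_in by (fastforce simp: level_perms_def)
  qed
qed

text \<open>Ensures that the Young symmetrizer is nonzero. If \<open>r \<circ> c = id\<close>, then
  \<open>c\<close> preserves rows as well as columns, so only the pair of identities
  contributes.\<close>

lemma young_coeff_id_id: "young_coeff id id = 1"
proof -
  have *: "(if r \<circ> id \<circ> c = id then sign c else 0) = (if r = id \<and> c = id then 1 else 0)"
    if "r \<in> level_perms S row" "c \<in> level_perms S col" for r c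
  proof (cases "r \<circ> c = id")
    case True
    have r: "r permutes S" and c: "c permutes S"
      using that by (auto simp: level_perms_def)
    have rc: "r (c x) = x" for x using True by (simp add: fun_eq_iff)
    have "row (c x) = row x" if "x \<in> S" for x
    proof -
      have "c x \<in> S" using that c by (simp add: permutes_in_image)
      then have "row (r (c x)) = row (c x)"
        using \<open>r \<in> level_perms S row\<close> by (simp add: level_perms_def)
      then show ?thesis by (simp add: rc)
    qed
    then have "c \<in> level_perms S row" using c by (simp add: level_perms_def)
    then have "c = id" using that level_perms_row_col by blast
    with True show ?thesis by simp
  qed auto
  have "young_coeff id id =
      (\<Sum>r\<in>level_perms S row. \<Sum>c\<in>level_perms S col. if r = id \<and> c = id then 1 else 0)"
    unfolding young_coeff_def by (intro sum.cong refl) (use * in auto)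
  also have "\<dots> = (\<Sum>r\<in>level_perms S row. if r = id then 1 else 0)"
    by (intro sum.cong refl) (simp add: finite_level_perms finite_S id_in_level_perms)
  also have "\<dots> = 1"
    by (simp add: finite_level_perms finite_S id_in_level_perms)
  finally show ?thesis .
qed

text \<open>The row sum absorbs row permutations, because right multiplication by \<open>p\<close>
  reindexes it.\<close>

lemma young_coeff_comp_left:
  assumes "p \<in> level_perms S row" "p \<circ> p = id"
  shows "young_coeff (p \<circ> t) g = young_coeff t g"
  using sum_level_perms_comp_right[OF assms,
      of "\<lambda>r. \<Sum>c\<in>level_perms S col. if r \<circ> t \<circ> c = g then sign c else 0"]
  by (simp add: young_coeff_def comp_assoc)

text \<open>The same reindexing on the column side, where multiplicativity of the sign costs a
  factor -1.\<close>

lemma young_coeff_comp_right: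
  assumes "x \<in> S" "y \<in> S" "x \<noteq> y" "col x = col y"
  shows "young_coeff (t \<circ> transpose x y) g = - young_coeff t g"
proof -
  let ?p = "transpose x y"
  have p: "?p \<in> level_perms S col" "?p \<circ> ?p = id"
    using assms transpose_in_level_perms by auto
  have sgn: "sign (?p \<circ> c) = - sign c" if "c \<in> level_perms S col" for c
    using sign_compose[OF permutation_swap_id level_perms_permutation[OF finite_S that], of x y]
    by (simp add: sign_swap_id assms)
  have "young_coeff (t \<circ> ?p) g = (\<Sum>r\<in>level_perms S row. \<Sum>c\<in>level_perms S col.
      - (if r \<circ> t \<circ> (?p \<circ> c) = g then sign (?p \<circ> c) else 0))"
    unfolding young_coeff_def by (intro sum.cong refl) (simp add: sgn comp_assoc)
  also have "\<dots> = - (\<Sum>r\<in>level_perms S row. \<Sum>c\<in>level_perms S col.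
      (if r \<circ> t \<circ> c = g then sign c else 0))"
    by (simp only: sum_negf
        sum_level_perms_comp_left[OF p, of "\<lambda>c. if _ \<circ> t \<circ> c = g then sign c else 0"])
  finally show ?thesis by (simp add: young_coeff_def)
qed

lemma young_coeff_row_transposition:
  assumes "t \<in> transpositions_on S" "t \<in> level_perms S row"
  shows "young_coeff t g = young_coeff id g"
  using young_coeff_comp_left[OF assms(2) transpositions_on_involutory[OF assms(1)], of id g]
  by simp

lemma young_coeff_col_transposition:
  assumes "t \<in> transpositions_on S" "t \<in> level_perms S col"
  shows "young_coeff t g = - young_coeff id g"
proof -
  obtain x y where xy: "x \<in> S" "y \<in> S" "x \<noteq> y" "t = transpose x y"
    using assms(1) by (auto simp: transpositions_on_def)
  then have "col (transpose x y x) = col x" using assms(2) unfolding level_perms_def by blast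
  then show ?thesis using young_coeff_comp_right[of x y id g] xy by simp
qed

text \<open>If \<open>t\<close> swaps \<open>x\<close> and \<open>y\<close>, and \<open>u\<close> shares its row with \<open>x\<close> and its column with \<open>y\<close>, then
  \<open>(x u) t = t (u y)\<close>; the left factor is absorbed by \<open>a\<close>, the right one changes the sign of \<open>b\<close>.\<close>

lemma young_coeff_other_transposition:
  assumes t: "t \<in> transpositions_on S"
    and nrow: "t \<notin> level_perms S row" and ncol: "t \<notin> level_perms S col"
  shows "young_coeff t g = 0"
proof -
  have *: "young_coeff (transpose x y) g = 0"
    if x: "x \<in> S" and y: "y \<in> S" and lt: "row x < row y" and cne: "col x \<noteq> col y" for x y
  proof -
    obtain u where u: "u \<in> S" "row u = row x" "col u = col y"
      using corner[OF x y lt] by blast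
    have ne: "u \<noteq> x" "u \<noteq> y" "x \<noteq> y" using u lt cne by auto
    have "transpose x u \<in> level_perms S row"
      by (rule transpose_in_level_perms) (use x u in auto)
    then have "young_coeff (transpose x y) g = young_coeff (transpose x u \<circ> transpose x y) g"
      by (subst young_coeff_comp_left) auto
    also have "transpose x u \<circ> transpose x y = transpose x y \<circ> transpose u y"
      using ne by (auto simp: fun_eq_iff Transposition.transpose_def)
    also have "young_coeff \<dots> g = - young_coeff (transpose x y) g"
      by (rule young_coeff_comp_right) (use y u ne in auto)
    finally show ?thesis by simp
  qed
  obtain x y where xy: "x \<in> S" "y \<in> S" "x \<noteq> y" "t = transpose x y"
    using t by (auto simp: transpositions_on_def)
  have "row x \<noteq> row y" "col x \<noteq> col y"
    using xy nrow ncol transpose_in_level_perms by metis+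
  then show ?thesis
    using *[of x y] *[of y x] xy by (metis linorder_neqE_nat transpose_commute)
qed

text \<open>Passage from z a b to a z b: \<open>r \<circ> c = t \<circ> g\<close> holds iff
  \<open>g = r \<circ> (inv' r \<circ> t \<circ> r) \<circ> c\<close>, and conjugation by
  \<open>r\<close> reindexes the transpositions.\<close>

lemma sum_young_coeff_transpositions:
  assumes "g permutes S"
  shows "(\<Sum>t\<in>transpositions_on S. young_coeff id (t \<circ> g)) =
    (\<Sum>t\<in>transpositions_on S. young_coeff t g)"
proof -
  let ?R = "level_perms S row" and ?C = "level_perms S col" and ?T = "transpositions_on S"
  have eq: "r \<circ> id \<circ> c = t \<circ> g \<longleftrightarrow> r \<circ> (inv' r \<circ> t \<circ> r) \<circ> c = g"
    if "r \<in> ?R" "t \<in> ?T" for r c t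
  proof -
    have r: "r permutes S" using that by (simp add: level_perms_def)
    have "r \<circ> (inv' r \<circ> t \<circ> r) \<circ> c = t \<circ> (r \<circ> c)"
      by (simp add: comp_assoc[symmetric] permutes_inv_o[OF r])
    moreover have "r \<circ> c = t \<circ> g \<longleftrightarrow> t \<circ> (r \<circ> c) = g"
      using transpositions_on_involutory[OF that(2)] by (metis comp_assoc id_comp)
    ultimately show ?thesis by simp
  qed
  have "(\<Sum>t\<in>?T. young_coeff id (t \<circ> g)) =
      (\<Sum>t\<in>?T. \<Sum>r\<in>?R. \<Sum>c\<in>?C. if r \<circ> (inv' r \<circ> t \<circ> r) \<circ> c = g then sign c else 0)"
    unfolding young_coeff_def by (intro sum.cong refl) (simp only: eq)
  also have "\<dots> = (\<Sum>r\<in>?R. \<Sum>t\<in>?T. \<Sum>c\<in>?C. if r \<circ> (inv' r \<circ> t \<circ> r) \<circ> c = g then sign c else 0)"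
    by (rule sum.swap)
  also have "\<dots> = (\<Sum>r\<in>?R. \<Sum>t\<in>?T. \<Sum>c\<in>?C. if r \<circ> t \<circ> c = g then sign c else 0)"
  proof (rule sum.cong[OF refl])
    fix r assume "r \<in> ?R"
    then have "r permutes S" by (simp add: level_perms_def)
    from sum.reindex_bij_betw[OF bij_betw_transpositions_on_conj[OF this],
        of "\<lambda>t. \<Sum>c\<in>?C. if r \<circ> t \<circ> c = g then sign c else 0"]
    show "(\<Sum>t\<in>?T. \<Sum>c\<in>?C. if r \<circ> (inv' r \<circ> t \<circ> r) \<circ> c = g then sign c else 0) =
        (\<Sum>t\<in>?T. \<Sum>c\<in>?C. if r \<circ> t \<circ> c = g then sign c else 0)" .
  qed
  also have "\<dots> = (\<Sum>t\<in>?T. young_coeff t g)"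
    unfolding young_coeff_def by (rule sum.swap)
  finally show ?thesis .
qed

lemma young_coeff_eigenfunction:
  assumes "g permutes S"
  shows "(\<Sum>t\<in>transpositions_on S. young_coeff id (t \<circ> g)) =
    (int (card (transpositions_on S \<inter> level_perms S row)) -
     int (card (transpositions_on S \<inter> level_perms S col))) * young_coeff id g"
proof -
  let ?R = "level_perms S row" and ?C = "level_perms S col" and ?T = "transpositions_on S"
  have fin: "finite ?T" by (rule finite_transpositions_on[OF finite_S])
  \<comment> \<open>Row and column group meet only in \<open>id\<close>, so no transposition falls
    under both cases.\<close>
  have "id \<notin> ?T" by (auto simp: transpositions_on_def transpose_eq_id_iff eq_commute[of id])
  then have nboth: "t \<notin> ?C" if "t \<in> ?T" "t \<in> ?R" for t
    using level_perms_row_col that by blast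
  have "(\<Sum>t\<in>?T. young_coeff t g) =
      (\<Sum>t\<in>?T. (if t \<in> ?R then young_coeff id g else 0) - (if t \<in> ?C then young_coeff id g else 0))"
    using nboth
    by (intro sum.cong refl) (auto simp: young_coeff_row_transposition
        young_coeff_col_transposition young_coeff_other_transposition)
  also have "\<dots> = (int (card (?T \<inter> ?R)) - int (card (?T \<inter> ?C))) * young_coeff id g"
    using fin by (simp add: sum_subtractf sum.inter_restrict[symmetric] left_diff_distrib)
  finally show ?thesis by (simp add: sum_young_coeff_transpositions[OF assms])
qed

end

section \<open>Counting the transpositions inside rows or columns\<close>

lemma card_transpositions_level:
  fixes f g :: "'a \<Rightarrow> nat"
  assumes fin: "finite S"
    and inj: "\<And>x y. \<lbrakk>x \<in> S; y \<in> S; f x = f y; g x = g y\<rbrakk> \<Longrightarrow> x = y"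
    and left_closed: "\<And>x j. \<lbrakk>x \<in> S; j < g x\<rbrakk> \<Longrightarrow> \<exists>u\<in>S. f u = f x \<and> g u = j"
  shows "card (transpositions_on S \<inter> level_perms S f) = sum g S"
proof -
  \<comment> \<open>Putting the entry with the larger \<open>g\<close>-value first makes the
    representation of a transposition unique; by \<open>left_closed\<close> and injectivity each
    \<open>x\<close> then has exactly \<open>g x\<close> partners.\<close>
  let ?P = "SIGMA x:S. {u\<in>S. f u = f x \<and> g u < g x}"
  have "bij_betw (\<lambda>(x, u). transpose x u) ?P (transpositions_on S \<inter> level_perms S f)"
    unfolding bij_betw_def
  proof
    show "inj_on (\<lambda>(x, u). transpose x u) ?P"
    proof (rule inj_onI, clarify)
      fix x u x' u' assume h: "g u < g x" "g u' < g x'" and eq: "transpose x u = transpose x' u'"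
      have "transpose x u x = transpose x' u' x" "transpose x u u = transpose x' u' u"
        by (simp_all add: eq)
      then show "x = x' \<and> u = u'"
        using h by (auto simp: Transposition.transpose_def split: if_splits)
    qed
    show "(\<lambda>(x, u). transpose x u) ` ?P = transpositions_on S \<inter> level_perms S f"
    proof (intro equalityI subsetI)
      fix t assume "t \<in> (\<lambda>(x, u). transpose x u) ` ?P"
      then obtain x u where "x \<in> S" "u \<in> S" "f u = f x" "g u < g x" "t = transpose x u" by auto
      then show "t \<in> transpositions_on S \<inter> level_perms S f"
        using transpose_in_level_perms[of x S u f] by (auto simp: transpositions_on_def)
    next
      fix t assume t: "t \<in> transpositions_on S \<inter> level_perms S f"
      then obtain x y where xy: "x \<in> S" "y \<in> S" "x \<noteq> y" "t = transpose x y"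
        by (auto simp: transpositions_on_def)
      then have "f (transpose x y x) = f x" using t unfolding level_perms_def by blast
      then have f: "f y = f x" by simp
      then have "g x \<noteq> g y" using inj xy by metis
      then consider "g y < g x" | "g x < g y" by linarith
      then show "t \<in> (\<lambda>(x, u). transpose x u) ` ?P"
      proof cases
        case 1
        then show ?thesis using xy f by (intro image_eqI[of _ _ "(x, y)"]) auto
      next
        case 2
        then show ?thesis using xy f
          by (intro image_eqI[of _ _ "(y, x)"]) (auto simp: transpose_commute)
      qed
    qed
  qed
  then have "card (transpositions_on S \<inter> level_perms S f) = card ?P"
    by (rule bij_betw_same_card[symmetric])
  also have "\<dots> = (\<Sum>x\<in>S. card {u\<in>S. f u = f x \<and> g u < g x})"
    by (rule card_SigmaI) (use fin in auto)
  also have "\<dots> = sum g S"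
  proof (rule sum.cong[OF refl])
    fix x assume x: "x \<in> S"
    have "bij_betw g {u\<in>S. f u = f x \<and> g u < g x} {..<g x}"
      unfolding bij_betw_def
    proof
      show "inj_on g {u\<in>S. f u = f x \<and> g u < g x}"
        by (rule inj_onI) (use inj in auto)
      show "g ` {u\<in>S. f u = f x \<and> g u < g x} = {..<g x}"
        using left_closed[OF x] by fastforce
    qed
    then show "card {u\<in>S. f u = f x \<and> g u < g x} = g x"
      by (simp add: bij_betw_same_card)
  qed
  finally show ?thesis .
qed

section \<open>Eigenvalues of the Cayley graph from Young diagrams\<close>

lemma transpositions_eq: "transpositions n = transpositions_on {1..n}"
  by (simp add: transpositions_def transpositions_on_def)

text \<open>A transposition is its own inverse, so \<open>f \<circ> inv' g = t\<close> and
  \<open>g = t \<circ> f\<close> are equivalent.\<close>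

lemma cayley_arc_iff:
  "(f, g) \<in> parcs (cayley_graph (sym_group n) (transpositions n)) \<longleftrightarrow>
     f permutes {1..n} \<and> (\<exists>t\<in>transpositions_on {1..n}. g = t \<circ> f)"
proof -
  have "f \<circ> inv' g \<in> transpositions_on {1..n} \<longleftrightarrow> (\<exists>t\<in>transpositions_on {1..n}. g = t \<circ> f)"
    if f: "f permutes {1..n}" and g: "g permutes {1..n}"
  proof
    assume t: "f \<circ> inv' g \<in> transpositions_on {1..n}"
    have "(f \<circ> inv' g) \<circ> f = (f \<circ> inv' g) \<circ> ((f \<circ> inv' g) \<circ> g)"
      by (simp add: comp_assoc permutes_inv_o[OF g])
    also have "\<dots> = ((f \<circ> inv' g) \<circ> (f \<circ> inv' g)) \<circ> g" by (simp only: comp_assoc)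
    also have "\<dots> = g" by (simp only: transpositions_on_involutory[OF t] id_comp)
    finally show "\<exists>t\<in>transpositions_on {1..n}. g = t \<circ> f" using t by metis
  next
    assume "\<exists>t\<in>transpositions_on {1..n}. g = t \<circ> f"
    then obtain t where t: "t \<in> transpositions_on {1..n}" "g = t \<circ> f" by blast
    have "t \<circ> g = f"
      using transpositions_on_involutory[OF t(1)] by (simp add: t(2) comp_assoc[symmetric])
    then have "f \<circ> inv' g = t" by (metis comp_assoc comp_id g permutes_inv_o(1))
    with t show "f \<circ> inv' g \<in> transpositions_on {1..n}" by simp
  qed
  moreover have "t \<circ> f permutes {1..n}"
    if "f permutes {1..n}" "t \<in> transpositions_on {1..n}" for t
    using that by (simp add: permutes_compose transpositions_on_permutes)
  ultimately show ?thesis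
    by (auto simp: cayley_graph_def transpositions_eq sym_group_carrier sym_group_mult)
qed

text \<open>The values of \<open>F\<close> along \<open>vs\<close> form an eigenvector: as
  \<open>t \<mapsto> t \<circ> f\<close> is injective, the sum over the neighbours of
  \<open>f\<close> is a sum over transpositions.\<close>

lemma eigenvalue_cayley_transpositions:
  fixes F :: "(nat \<Rightarrow> nat) \<Rightarrow> real"
  assumes "distinct vs"
    and vs: "set vs = pverts (cayley_graph (sym_group n) (transpositions n))"
    and eig: "\<And>g. g permutes {1..n} \<Longrightarrow> (\<Sum>t\<in>transpositions_on {1..n}. F (t \<circ> g)) = k * F g"
    and nz: "g permutes {1..n}" "F g \<noteq> 0"
  shows "eigenvalue (adjacency_mat (cayley_graph (sym_group n) (transpositions n)) vs) k"
proof -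
  let ?G = "cayley_graph (sym_group n) (transpositions n)"
  let ?N = "length vs" and ?T = "transpositions_on {1..n}"
  let ?A = "adjacency_mat ?G vs"
  define v where "v = vec ?N (\<lambda>i. F (vs ! i))"
  have verts: "set vs = {p. p permutes {1..n}}"
    by (simp add: vs cayley_graph_def sym_group_def)
  have bij: "bij_betw ((!) vs) {..<?N} (set vs)"
    using \<open>distinct vs\<close> by (rule bij_betw_nth) auto
  have "?A *\<^sub>v v = k \<cdot>\<^sub>v v"
  proof (rule eq_vecI)
    fix i assume "i < dim_vec (k \<cdot>\<^sub>v v)"
    then have i: "i < ?N" by (simp add: v_def)
    let ?f = "vs ! i"
    have f: "?f permutes {1..n}" using nth_mem[OF i] verts by simp
    have inj: "inj_on (\<lambda>t. t \<circ> ?f) ?T"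
    proof (rule inj_onI)
      fix s t :: "nat \<Rightarrow> nat" assume "s \<circ> ?f = t \<circ> ?f"
      then show "s = t" by (metis comp_assoc comp_id permutes_inv_o(1)[OF f])
    qed
    have img: "(\<lambda>t. t \<circ> ?f) ` ?T = {g\<in>set vs. (?f, g) \<in> parcs ?G}"
      using f by (auto simp: cayley_arc_iff verts permutes_compose transpositions_on_permutes)
    have "(?A *\<^sub>v v) $ i = (\<Sum>j<?N. (if (?f, vs ! j) \<in> parcs ?G then 1 else 0) * F (vs ! j))"
      using i by (simp add: adjacency_mat_def v_def scalar_prod_def atLeast0LessThan)
    also have "\<dots> = (\<Sum>g\<in>set vs. (if (?f, g) \<in> parcs ?G then 1 else 0) * F g)"
      by (rule sum.reindex_bij_betw[OF bij])
    also have "\<dots> = (\<Sum>g\<in>set vs. if (?f, g) \<in> parcs ?G then F g else 0)"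
      by (intro sum.cong) auto
    also have "\<dots> = (\<Sum>g | g \<in> set vs \<and> (?f, g) \<in> parcs ?G. F g)"
      by (simp add: sum.If_cases Int_def)
    also have "\<dots> = (\<Sum>t\<in>?T. F (t \<circ> ?f))"
      unfolding img[symmetric] by (subst sum.reindex[OF inj]) simp
    also have "\<dots> = k * F ?f" by (rule eig[OF f])
    finally show "(?A *\<^sub>v v) $ i = (k \<cdot>\<^sub>v v) $ i" using i by (simp add: v_def)
  qed (simp add: adjacency_mat_def v_def)
  moreover have "v \<noteq> 0\<^sub>v ?N"
  proof
    assume v0: "v = 0\<^sub>v ?N"
    obtain i where "i < ?N" "vs ! i = g" using nz verts by (metis in_set_conv_nth mem_Collect_eq)
    then show False using arg_cong[OF v0, of "\<lambda>w. w $ i"] nz by (simp add: v_def)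
  qed
  ultimately have "eigenvector ?A v k"
    by (simp add: eigenvector_def adjacency_mat_def v_def)
  then show ?thesis by (auto simp: eigenvalue_def)
qed

text \<open>Boxes are pairs (row, column) counted from 0, so the box (i, j) has content j -
  i.\<close>

definition young_diagram :: "(nat \<times> nat) set \<Rightarrow> bool" where
  "young_diagram D \<longleftrightarrow> finite D \<and> (\<forall>i j i' j'. (i, j) \<in> D \<and> i' \<le> i \<and> j' \<le> j \<longrightarrow> (i', j') \<in> D)"

theorem content_eigenvalue:
  assumes D: "young_diagram D" "card D = n"
    and vs: "distinct vs" "set vs = pverts (cayley_graph (sym_group n) (transpositions n))"
  shows "eigenvalue (adjacency_mat (cayley_graph (sym_group n) (transpositions n)) vs)
    (of_int (\<Sum>(i, j)\<in>D. int j - int i))"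
proof -
  have finD: "finite D" and closed: "\<And>i j i' j'. \<lbrakk>(i, j) \<in> D; i' \<le> i; j' \<le> j\<rbrakk> \<Longrightarrow> (i', j') \<in> D"
    using D(1) by (auto simp: young_diagram_def)
  let ?S = "{1..n}"
  \<comment> \<open>Any filling of the boxes will do, since the eigenvalue depends on the shape
    alone.\<close>
  obtain \<phi> where \<phi>: "bij_betw \<phi> ?S D"
    using finite_same_card_bij[of ?S D] finD D(2) by auto
  define row where "row x = fst (\<phi> x)" for x
  define col where "col x = snd (\<phi> x)" for x
  have pos: "(row x, col x) \<in> D" if "x \<in> ?S" for x
    unfolding row_def col_def prod.collapse using \<phi> that by (rule bij_betw_apply)
  have ex: "\<exists>u\<in>?S. row u = i \<and> col u = j" if "(i, j) \<in> D" for i j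
  proof -
    have "(i, j) \<in> \<phi> ` ?S" using \<phi> that by (simp only: bij_betw_imp_surj_on)
    then obtain u where "u \<in> ?S" "\<phi> u = (i, j)" by (elim imageE) (simp only:)
    then show ?thesis by (intro bexI[of _ u]) (simp_all add: row_def col_def)
  qed
  have inj: "x = y" if "x \<in> ?S" "y \<in> ?S" "row x = row y" "col x = col y" for x y
    by (rule inj_onD[OF bij_betw_imp_inj_on[OF \<phi>]])
      (use that in \<open>simp_all add: row_def col_def prod_eqI\<close>)
  interpret tableau ?S row col
  proof
    fix x y assume "x \<in> ?S" "y \<in> ?S" "row x < row y"
    then show "\<exists>u\<in>?S. row u = row x \<and> col u = col y"
      by (intro ex closed[OF pos[of y]]) simp_all
  qed (simp, rule inj)
  \<comment> \<open>A box in column j has j boxes to its left, so the row transpositions are counted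
    by column indices; dually for columns.\<close>
  have rows: "card (transpositions_on ?S \<inter> level_perms ?S row) = sum col ?S"
  proof (rule card_transpositions_level)
    fix x j assume "x \<in> ?S" "j < col x"
    then show "\<exists>u\<in>?S. row u = row x \<and> col u = j" by (intro ex closed[OF pos[of x]]) simp_all
  qed (simp, use inj in blast)
  have cols: "card (transpositions_on ?S \<inter> level_perms ?S col) = sum row ?S"
  proof (rule card_transpositions_level)
    fix x i assume "x \<in> ?S" "i < row x"
    then have "(i, col x) \<in> D" by (intro closed[OF pos[of x]]) simp_all
    then show "\<exists>u\<in>?S. col u = col x \<and> row u = i" using ex by blast
  qed (simp, use inj in blast)
  have "int (sum col ?S) - int (sum row ?S) = (\<Sum>x\<in>?S. case \<phi> x of (i, j) \<Rightarrow> int j - int i)"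
    by (simp add: sum_subtractf row_def col_def case_prod_unfold)
  also have "\<dots> = (\<Sum>(i, j)\<in>D. int j - int i)" by (rule sum.reindex_bij_betw[OF \<phi>])
  finally have content: "int (sum col ?S) - int (sum row ?S) = (\<Sum>(i, j)\<in>D. int j - int i)" .
  show ?thesis
  proof (rule eigenvalue_cayley_transpositions[OF vs, where F = "\<lambda>g. of_int (young_coeff id g)"])
    fix g assume g: "g permutes ?S"
    show "(\<Sum>t\<in>transpositions_on ?S. of_int (young_coeff id (t \<circ> g))) =
        of_int (\<Sum>(i, j)\<in>D. int j - int i) * (of_int (young_coeff id g) :: real)"
      using young_coeff_eigenfunction[OF g] rows cols content
      by (simp only: of_int_sum[symmetric] of_int_mult[symmetric])
  next
    show "id permutes ?S" by (rule permutes_id)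
    show "of_int (young_coeff id id) \<noteq> (0 :: real)"
      by (simp only: young_coeff_id_id of_int_1 one_neq_zero not_False_eq_True)
  qed
qed

section \<open>Contents of partitions\<close>

text \<open>Partitions are given by their Frobenius symbol, the list of pairs (arm, leg) of the diagonal
  boxes; \<open>frobenius A B\<close> says that the diagram has at most \<open>A\<close> columns and \<open>B\<close> rows.\<close>

fun frobenius :: "nat \<Rightarrow> nat \<Rightarrow> (nat \<times> nat) list \<Rightarrow> bool" where
  "frobenius A B [] \<longleftrightarrow> True"
| "frobenius A B ((a, b) # xs) \<longleftrightarrow> a < A \<and> b < B \<and> frobenius a b xs"

fun frobenius_size :: "(nat \<times> nat) list \<Rightarrow> nat" where
  "frobenius_size [] = 0"
| "frobenius_size ((a, b) # xs) = a + b + 1 + frobenius_size xs"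

text \<open>The arm carries the contents 1..a and the leg -1..-b; contents are constant along
  diagonals, so the inner hooks contribute unchanged.\<close>

fun frobenius_content :: "(nat \<times> nat) list \<Rightarrow> int" where
  "frobenius_content [] = 0"
| "frobenius_content ((a, b) # xs) =
     int (a * (a + 1) div 2) - int (b * (b + 1) div 2) + frobenius_content xs"

fun frobenius_diagram :: "(nat \<times> nat) list \<Rightarrow> (nat \<times> nat) set" where
  "frobenius_diagram [] = {}"
| "frobenius_diagram ((a, b) # xs) =
     {0} \<times> {..a} \<union> {1..b} \<times> {0} \<union> map_prod Suc Suc ` frobenius_diagram xs"

lemma finite_frobenius_diagram: "finite (frobenius_diagram xs)"
  by (induction xs rule: frobenius_diagram.induct) auto

lemma frobenius_diagram_bounded:
  "frobenius A B xs \<Longrightarrow> frobenius_diagram xs \<subseteq> {..<B} \<times> {..<A}"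
  by (induction A B xs rule: frobenius.induct) fastforce+

lemma young_diagram_frobenius: "frobenius A B xs \<Longrightarrow> young_diagram (frobenius_diagram xs)"
proof (induction A B xs rule: frobenius.induct)
  case (2 A B a b xs)
  let ?D = "frobenius_diagram xs"
  \<comment> \<open>Here the strict decrease of arms and legs enters: after the diagonal shift the
    inner boxes lie in rows 1..b and columns 1..a, inside the outer hook.\<close>
  have bd: "?D \<subseteq> {..<b} \<times> {..<a}" using 2 frobenius_diagram_bounded by simp
  have closed: "(i', j') \<in> ?D" if "(i, j) \<in> ?D" "i' \<le> i" "j' \<le> j" for i j i' j'
    using 2 that by (auto simp: young_diagram_def)
  have step: "(i', j') \<in> frobenius_diagram ((a, b) # xs)"
    if ij: "(i, j) \<in> frobenius_diagram ((a, b) # xs)" "i' \<le> i" "j' \<le> j" for i j i' j'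
  proof (cases "i = 0 \<or> j = 0")
    case True
    then show ?thesis using ij by auto
  next
    case False
    then obtain k l where kl: "i = Suc k" "j = Suc l" "(k, l) \<in> ?D" using ij by auto
    then have bound: "k < b" "l < a" using bd by auto
    show ?thesis
    proof (cases "i' = 0 \<or> j' = 0")
      case True
      then show ?thesis using ij kl bound by auto
    next
      case False
      then obtain k' l' where "i' = Suc k'" "j' = Suc l'" by (metis not0_implies_Suc)
      then show ?thesis using closed[OF kl(3), of k' l'] ij kl by force
    qed
  qed
  show ?case
    unfolding young_diagram_def
    by (intro conjI allI impI finite_frobenius_diagram) (elim conjE, rule step)
qed (simp add: young_diagram_def)

text \<open>Taken with \<open>f\<close> constantly 1 it gives the recursion for the size, with
  \<open>f\<close> the content that for the content.\<close>

lemma sum_frobenius_diagram_Cons: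
  fixes f :: "nat \<times> nat \<Rightarrow> 'b::comm_monoid_add"
  shows "sum f (frobenius_diagram ((a, b) # xs)) =
    (\<Sum>j\<le>a. f (0, j)) + (\<Sum>i=1..b. f (i, 0)) + (\<Sum>(i, j)\<in>frobenius_diagram xs. f (Suc i, Suc j))"
proof -
  let ?D = "frobenius_diagram xs"
  have "sum f (frobenius_diagram ((a, b) # xs)) =
      sum f ({0} \<times> {..a}) + sum f ({1..b} \<times> {0}) + sum f (map_prod Suc Suc ` ?D)"
    unfolding frobenius_diagram.simps
    by (subst sum.union_disjoint, use finite_frobenius_diagram in auto)+
  also have "sum f ({0} \<times> {..a}) = (\<Sum>j\<le>a. f (0, j))"
    by (simp add: sum.cartesian_product')
  also have "sum f ({1..b} \<times> {0}) = (\<Sum>i=1..b. f (i, 0))"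
    by (simp add: sum.cartesian_product')
  also have "sum f (map_prod Suc Suc ` ?D) = (\<Sum>(i, j)\<in>?D. f (Suc i, Suc j))"
    by (subst sum.reindex) (auto simp: inj_on_def intro!: sum.cong)
  finally show ?thesis .
qed

lemma card_frobenius_diagram: "card (frobenius_diagram xs) = frobenius_size xs"
proof (induction xs rule: frobenius_diagram.induct)
  case (2 a b xs)
  then show ?case
    unfolding card_eq_sum sum_frobenius_diagram_Cons by simp
qed simp

lemma content_frobenius_diagram:
  "(\<Sum>(i, j)\<in>frobenius_diagram xs. int j - int i) = frobenius_content xs"
proof (induction xs rule: frobenius_diagram.induct)
  case (2 a b xs)
  have row: "(\<Sum>j\<le>m. int j) = int (m * (m + 1) div 2)" for m
    using gauss_sum_nat[of m] by (simp add: atMost_atLeast0 flip: of_nat_sum)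
  have col: "(\<Sum>i=1..m. int i) = int (m * (m + 1) div 2)" for m
    unfolding row[symmetric] by (rule sum.mono_neutral_left) auto
  have "(\<Sum>(i, j)\<in>frobenius_diagram ((a, b) # xs). int j - int i) =
      (\<Sum>j\<le>a. int j) - (\<Sum>i=1..b. int i) + (\<Sum>(i, j)\<in>frobenius_diagram xs. int j - int i)"
    unfolding sum_frobenius_diagram_Cons by (simp add: sum_negf)
  then show ?case using "2.IH" unfolding row col by simp
qed simp

section \<open>Ranges of contents and the hook step\<close>

text \<open>\<open>K\<close> measures the range of contents. \<open>L\<close> keeps track of room
  for the next step: every hook with arm and leg at least \<open>L\<close> fits around these
  partitions.\<close>

definition realizable :: "nat \<Rightarrow> nat \<Rightarrow> nat \<Rightarrow> bool" where
  "realizable n K L \<longleftrightarrow> (\<forall>k. \<bar>k\<bar> \<le> int K \<longrightarrow>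
     (\<exists>xs. frobenius L L xs \<and> frobenius_size xs = n \<and> frobenius_content xs = k))"

lemma frobenius_swap: "frobenius A B xs \<Longrightarrow> frobenius B A (map prod.swap xs)"
  by (induction A B xs rule: frobenius.induct) auto

lemma frobenius_size_swap: "frobenius_size (map prod.swap xs) = frobenius_size xs"
  by (induction xs rule: frobenius_size.induct) auto

lemma frobenius_content_swap: "frobenius_content (map prod.swap xs) = - frobenius_content xs"
  by (induction xs rule: frobenius_content.induct) auto

lemma frobenius_mono: "frobenius A B xs \<Longrightarrow> A \<le> A' \<Longrightarrow> B \<le> B' \<Longrightarrow> frobenius A' B' xs"
  by (cases xs) auto

lemma frobenius_frobenius_size:
  "frobenius A B xs \<Longrightarrow> frobenius (frobenius_size xs) (frobenius_size xs) xs"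
  by (cases xs) auto

lemma realizable_weaken: "realizable n K L \<Longrightarrow> K' \<le> K \<Longrightarrow> realizable n K' n"
  unfolding realizable_def by (metis frobenius_frobenius_size of_nat_mono order_trans)

text \<open>Nonnegative contents suffice in a table: conjugating a partition exchanges arms and legs
  and negates its content.\<close>

lemma realizable_table:
  assumes "list_all (\<lambda>xs. frobenius L L xs \<and> frobenius_size xs = n) tab"
    and "map frobenius_content tab = [0..int K]"
  shows "realizable n K L"
  unfolding realizable_def
proof (intro allI impI)
  fix k :: int assume k: "\<bar>k\<bar> \<le> int K"
  then have "\<bar>k\<bar> \<in> set (map frobenius_content tab)" by (simp add: assms(2))
  then obtain xs where xs: "frobenius L L xs" "frobenius_size xs = n" "frobenius_content xs = \<bar>k\<bar>"
    using assms(1) by (auto simp: list_all_iff)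
  show "\<exists>xs. frobenius L L xs \<and> frobenius_size xs = n \<and> frobenius_content xs = k"
  proof (cases "k \<ge> 0")
    case True
    then show ?thesis using xs by auto
  next
    case False
    then show ?thesis using xs frobenius_swap
      by (intro exI[of _ "map prod.swap xs"])
        (auto simp: frobenius_size_swap frobenius_content_swap)
  qed
qed

text \<open>Wrapping a hook with arm \<open>g + i\<close> and leg \<open>g - i\<close> around a diagram adds \<open>(2 g + 1) i\<close> to the
  content.\<close>

lemma realizable_add_hook:
  assumes "realizable s R L" "g \<le> R" "L + I \<le> g"
  shows "realizable (s + 2 * g + 1) ((2 * g + 1) * I + g) (g + I + 1)"
  unfolding realizable_def
proof (intro allI impI)
  fix k :: int assume k: "\<bar>k\<bar> \<le> int ((2 * g + 1) * I + g)"
  define h where "h = 2 * int g + 1"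
  \<comment> \<open>Division with centred remainder: shifting by \<open>g\<close> first puts
    \<open>r\<close> between -g and g, hence within the range \<open>R\<close> of the inner
    partitions.\<close>
  define i where "i = (k + int g) div h"
  define r where "r = k - h * i"
  have h: "h > 0" by (simp add: h_def)
  have "r = (k + int g) mod h - int g"
    by (simp add: r_def i_def minus_div_mult_eq_mod[symmetric] algebra_simps)
  then have r: "\<bar>r\<bar> \<le> int g"
    using pos_mod_sign[OF h, of "k + int g"] pos_mod_bound[OF h, of "k + int g"]
    unfolding h_def by linarith
  \<comment> \<open>\<open>h * I + g\<close> is the largest \<open>k\<close> whose rounded quotient
    is still \<open>I\<close>, whence the form of the new range.\<close>
  have "h * (- int I) \<le> k + int g" "k + int g < h * (int I + 1)"
    using k by (auto simp: h_def algebra_simps abs_le_iff)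
  then have "h * (- int I) < h * (i + 1)" "h * i < h * (int I + 1)"
    using r h by (auto simp: r_def h_def algebra_simps)
  then have "- int I < i + 1" "i < int I + 1"
    using h unfolding mult_less_cancel_left_pos[OF h] by blast+
  then have i: "\<bar>i\<bar> \<le> int I" by linarith
  obtain xs where xs: "frobenius L L xs" "frobenius_size xs = s" "frobenius_content xs = r"
    using assms(1,2) r unfolding realizable_def by (meson of_nat_mono order_trans)
  define a where "a = nat (int g + i)"
  define b where "b = nat (int g - i)"
  have a: "int a = int g + i" and b: "int b = int g - i"
    using i assms(3) by (auto simp: a_def b_def)
  have ab: "L \<le> a" "L \<le> b" "a < g + I + 1" "b < g + I + 1" "a + b = 2 * g"
    using a b i assms(3) by linarith+
  \<comment> \<open>Doubling removes \<open>div 2\<close>: (g+i)(g+i+1) - (g-i)(g-i+1) =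
    2(2g+1)i.\<close>
  have tri: "2 * int (m * (m + 1) div 2) = int m * (int m + 1)" for m :: nat
  proof -
    have "2 * (m * (m + 1) div 2) = m * (m + 1)" by simp
    then show ?thesis by (metis of_nat_1 of_nat_add of_nat_mult of_nat_numeral)
  qed
  have "2 * (int (a * (a + 1) div 2) - int (b * (b + 1) div 2)) = 2 * (h * i)"
    unfolding right_diff_distrib tri a b h_def by (simp add: algebra_simps)
  then have "frobenius_content ((a, b) # xs) = k" using xs by (simp add: r_def)
  moreover have "frobenius (g + I + 1) (g + I + 1) ((a, b) # xs)"
    using ab xs frobenius_mono by auto
  moreover have "frobenius_size ((a, b) # xs) = s + 2 * g + 1" using ab xs by simp
  ultimately show "\<exists>xs. frobenius (g + I + 1) (g + I + 1) xs \<and>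
      frobenius_size xs = s + 2 * g + 1 \<and> frobenius_content xs = k" by blast
qed

text \<open>\<open>I = g - L\<close> is the largest tilt for which the shorter side of the hook is
  still at least \<open>L\<close>.\<close>

lemma realizable_add_hook_max:
  assumes "realizable s R L" "g \<le> R" "L \<le> g" "n = s + 2 * g + 1"
    and "K \<le> (2 * g + 1) * (g - L) + g"
  shows "realizable n K n"
  using realizable_weaken[OF realizable_add_hook[OF assms(1,2), of "g - L"] assms(5)] assms(3,4)
  by simp

section \<open>Estimates for the required bound\<close>

abbreviation bound :: "nat \<Rightarrow> nat" where
  "bound n \<equiv> ((n - 15) div 3) choose 2"

text \<open>For a fixed base \<open>s\<close> and hooks with \<open>g\<close> from \<open>lo\<close>
  to \<open>hi\<close>, the inequality becomes a finite numerical check.\<close>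

lemma realizable_bound_range:
  assumes "realizable s R L" "n = s + 2 * g + 1" "g \<le> R" "L \<le> lo" "lo \<le> g" "g \<le> hi"
    and "list_all (\<lambda>g. bound (s + 2 * g + 1) \<le> (2 * g + 1) * (g - L) + g) [lo..<Suc hi]"
  shows "realizable n (bound n) n"
proof (rule realizable_add_hook_max[OF assms(1,3) _ assms(2)])
  have "g \<in> set [lo..<Suc hi]" using assms(5,6) by auto
  then show "bound n \<le> (2 * g + 1) * (g - L) + g"
    using assms(7) unfolding list_all_iff assms(2) by blast
qed (use assms in auto)

lemma two_choose_two: "2 * int (m choose 2) = int m * (int m - 1)"
proof -
  have "even (m * (m - 1))" by (cases m) auto
  then have "2 * (m choose 2) = m * (m - 1)" by (simp only: choose_two dvd_mult_div_cancel)
  then have "int (2 * (m choose 2)) = int (m * (m - 1))" by (simp only:)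
  then show ?thesis by (cases m) (auto simp: algebra_simps)
qed

text \<open>With \<open>m = (n - 15) div 3\<close> one has 18 * \<open>bound n\<close> = 3m(3m - 3),
  and n - 17 \<le> 3m \<le> n - 15; the two ends give this estimate and
  \<open>bound_lower\<close>.\<close>

lemma bound_upper: "n \<ge> 18 \<Longrightarrow> 18 * int (bound n) \<le> (int n - 15) * (int n - 18)"
proof -
  assume n: "n \<ge> 18"
  define m where "m = (n - 15) div 3"
  have m: "3 * int m \<le> int n - 15" "m \<ge> 1" using n unfolding m_def by linarith+
  have "18 * int (bound n) = (3 * int m) * (3 * int m - 3)"
    using two_choose_two[of m] by (simp add: m_def algebra_simps)
  also have "\<dots> \<le> (int n - 15) * (int n - 18)"
    using m n by (intro mult_mono) auto
  finally show ?thesis .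
qed

lemma bound_lower: "n \<ge> 20 \<Longrightarrow> (int n - 17) * (int n - 20) \<le> 18 * int (bound n)"
proof -
  assume n: "n \<ge> 20"
  define m where "m = (n - 15) div 3"
  have m: "3 * int m \<ge> int n - 17" "m \<ge> 1" using n unfolding m_def by linarith+
  have "(int n - 17) * (int n - 20) \<le> (3 * int m) * (3 * int m - 3)"
    using m n by (intro mult_mono) auto
  also have "\<dots> = 18 * int (bound n)"
    using two_choose_two[of m] by (simp add: m_def algebra_simps)
  finally show ?thesis .
qed

text \<open>The \<open>k\<close>-th entry of each table is a partition of content \<open>k\<close>, found by exhaustive search.\<close>

lemma realizable_13_12: "realizable 13 12 6"
  by (rule realizable_table[where tab =
    "[[(3, 3), (2, 2), (0, 0)], [(5, 5), (1, 0)], [(4, 4), (2, 1)], [(3, 3), (2, 1), (1, 0)],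
      [(4, 3), (2, 2)], [(5, 4), (1, 1)], [(4, 4), (3, 0)], [(5, 3), (1, 2)], [(5, 4), (2, 0)],
      [(4, 3), (3, 1)], [(4, 2), (2, 1), (1, 0)], [(5, 3), (2, 1)], [(4, 2), (3, 1), (0, 0)]]"])
    code_simp+

lemma realizable_19_37: "realizable 19 37 9"
  by (rule realizable_table[where tab =
    "[[(4, 4), (3, 3), (1, 1)], [(5, 6), (4, 2)], [(7, 6), (1, 3)], [(6, 6), (3, 2)],
      [(5, 5), (4, 3)], [(8, 7), (0, 2)], [(6, 5), (3, 3)], [(7, 6), (2, 2)], [(8, 7), (1, 1)],
      [(6, 6), (4, 1)], [(7, 5), (2, 3)], [(8, 5), (0, 4)], [(7, 6), (3, 1)], [(6, 5), (4, 2)],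
      [(5, 3), (3, 2), (2, 1)], [(6, 4), (4, 3)], [(7, 5), (3, 2)], [(7, 6), (4, 0)],
      [(7, 4), (3, 3)], [(5, 3), (4, 2), (2, 0)], [(6, 5), (5, 1)], [(8, 5), (2, 2)],
      [(7, 5), (4, 1)], [(6, 4), (5, 2)], [(5, 3), (4, 1), (3, 0)], [(7, 4), (4, 2)],
      [(8, 5), (3, 1)], [(6, 3), (4, 1), (2, 0)], [(7, 5), (5, 0)], [(8, 4), (3, 2)],
      [(6, 3), (5, 1), (1, 0)], [(8, 5), (4, 0)], [(7, 4), (5, 1)], [(6, 2), (4, 1), (3, 0)],
      [(7, 3), (5, 2)], [(8, 4), (4, 1)], [(7, 3), (5, 1), (0, 0)], [(8, 3), (4, 2)]]"])
    code_simp+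

lemma realizable_20_20: "realizable 20 20 7"
  by (rule realizable_table[where tab =
    "[[(5, 5), (4, 4)], [(5, 5), (3, 3), (1, 0)], [(6, 5), (3, 4)], [(5, 5), (3, 2), (1, 1)],
      [(5, 5), (4, 3), (0, 0)], [(5, 4), (3, 3), (1, 1)], [(5, 5), (3, 2), (2, 0)],
      [(6, 6), (4, 2)], [(5, 4), (3, 3), (2, 0)], [(6, 6), (4, 1), (0, 0)], [(6, 5), (4, 3)],
      [(6, 4), (2, 2), (1, 1), (0, 0)], [(5, 4), (4, 2), (1, 1)], [(6, 5), (4, 2), (0, 0)],
      [(6, 6), (5, 1)], [(5, 4), (4, 2), (2, 0)], [(6, 5), (4, 1), (1, 0)],
      [(6, 4), (3, 2), (2, 0)], [(6, 5), (5, 2)], [(6, 4), (4, 2), (1, 0)], [(6, 4), (5, 3)]]"])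
    code_simp+

lemma realizable_15_0: "realizable 15 0 15"
  by (rule realizable_table[where tab =
    "[[(7, 7)]]"])
    code_simp+

lemma realizable_16_0: "realizable 16 0 16"
  by (rule realizable_table[where tab =
    "[[(4, 4), (3, 3)]]"])
    code_simp+

lemma realizable_17_0: "realizable 17 0 17"
  by (rule realizable_table[where tab =
    "[[(8, 8)]]"])
    code_simp+

lemma realizable_18_0: "realizable 18 0 18"
  by (rule realizable_table[where tab =
    "[[(5, 5), (3, 3)]]"])
    code_simp+

lemma realizable_21_1: "realizable 21 1 21"
  by (rule realizable_table[where tab =
    "[[(10, 10)], [(9, 9), (1, 0)]]"])
    code_simp+

lemma realizable_22_1: "realizable 22 1 22"
  by (rule realizable_table[where tab =
    "[[(6, 6), (4, 4)], [(7, 8), (4, 1)]]"])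
    code_simp+

lemma realizable_23_1: "realizable 23 1 23"
  by (rule realizable_table[where tab =
    "[[(11, 11)], [(8, 7), (2, 4)]]"])
    code_simp+

lemma realizable_24_3: "realizable 24 3 24"
  by (rule realizable_table[where tab =
    "[[(6, 6), (5, 5)], [(6, 6), (4, 3), (0, 2)], [(7, 6), (4, 5)], [(9, 7), (1, 5)]]"])
    code_simp+

lemma realizable_25_3: "realizable 25 3 25"
  by (rule realizable_table[where tab =
    "[[(12, 12)], [(7, 8), (5, 3)], [(9, 8), (2, 4)], [(7, 9), (6, 1)]]"])
    code_simp+

lemma realizable_27_6: "realizable 27 6 27"
  by (rule realizable_table[where tab =
    "[[(13, 13)], [(8, 10), (6, 1)], [(9, 7), (3, 6)], [(7, 8), (6, 4)], [(9, 9), (4, 3)],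
      [(8, 8), (5, 4)], [(7, 7), (6, 5)]]"])
    code_simp+

lemma realizable_29_6: "realizable 29 6 29"
  by (rule realizable_table[where tab =
    "[[(14, 14)], [(10, 9), (3, 5)], [(8, 9), (6, 4)], [(10, 11), (5, 1)], [(10, 8), (3, 6)],
      [(9, 9), (5, 4)], [(8, 8), (6, 5)]]"])
    code_simp+

lemma realizable_31_10: "realizable 31 10 31"
  by (rule realizable_table[where tab =
    "[[(15, 15)], [(9, 10), (6, 4)], [(11, 10), (3, 5)], [(9, 12), (8, 0)], [(8, 9), (7, 5)],
      [(10, 10), (5, 4)], [(9, 9), (6, 5)], [(8, 8), (7, 6)], [(11, 8), (3, 7)],
      [(9, 8), (6, 6)], [(10, 9), (5, 5)]]"])
    code_simp+

lemma realizable_33_15: "realizable 33 15 33"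
  by (rule realizable_table[where tab =
    "[[(16, 16)], [(12, 13), (5, 1)], [(10, 12), (7, 2)], [(9, 10), (7, 5)],
      [(12, 12), (4, 3)], [(11, 11), (5, 4)], [(10, 10), (6, 5)], [(9, 9), (7, 6)],
      [(12, 10), (3, 6)], [(9, 8), (7, 7)], [(10, 9), (6, 6)], [(10, 11), (7, 3)],
      [(10, 8), (6, 7)], [(13, 11), (2, 5)], [(14, 13), (2, 2)], [(11, 9), (5, 6)]]"])
    code_simp+

lemma realizable_35_15: "realizable 35 15 35"
  by (rule realizable_table[where tab =
    "[[(17, 17)], [(12, 11), (4, 6)], [(10, 11), (7, 5)], [(13, 10), (2, 8)],
      [(13, 12), (3, 5)], [(9, 10), (8, 6)], [(11, 11), (6, 5)], [(10, 10), (7, 6)],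
      [(9, 9), (8, 7)], [(14, 14), (4, 1)], [(10, 9), (7, 7)], [(11, 10), (6, 6)],
      [(12, 11), (5, 5)], [(13, 12), (4, 4)], [(11, 9), (6, 7)], [(10, 11), (8, 4)]]"])
    code_simp+

section \<open>Sizes below 244\<close>

text \<open>One hook step turns small tables into bases with wider ranges: here 32 = 13 + 19, 28 =
  19 * 1 + 9 and 11 = 9 + 1 + 1. The bases 36 and 45 arise likewise.\<close>

lemma realizable_32: "realizable 32 28 11"
  using realizable_add_hook[OF realizable_13_12, of 9 1] by simp

lemma realizable_36: "realizable 36 103 16"
  using realizable_add_hook[OF realizable_13_12, of 11 4] by simp

lemma realizable_45: "realizable 45 112 17"
  using realizable_add_hook[OF realizable_20_20, of 12 4] by simp

text \<open>The tables reach exactly \<open>bound n\<close>, except at 19 and 20, where the bound is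
  0 and the larger tables also serve as bases.\<close>

lemma realizable_small:
  assumes "15 \<le> n" "n < 26 \<or> odd n \<and> n < 36"
  shows "realizable n (bound n) n"
proof -
  have "n \<in> {15, 16, 17, 18, 19, 20, 21, 22, 23, 24, 25, 27, 29, 31, 33, 35}"
    using assms by (simp, presburger)
  then show ?thesis
    using realizable_weaken[OF realizable_19_37, of 0] realizable_weaken[OF realizable_20_20, of 0]
    by (auto simp: choose_two realizable_15_0 realizable_16_0 realizable_17_0 realizable_18_0
        realizable_21_1[simplified] realizable_22_1[simplified] realizable_23_1[simplified]
        realizable_24_3 realizable_25_3
        realizable_27_6 realizable_29_6 realizable_31_10 realizable_33_15 realizable_35_15)
qed

text \<open>Hooks here have odd size, so even \<open>n\<close> calls for odd bases: 13, 19 and 45.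
  The value of \<open>g\<close> solves \<open>n = s + 2 * g + 1\<close>; the first two ranges end
  where \<open>g\<close> exhausts the content range of the base.\<close>

lemma realizable_even:
  assumes "even n" "26 \<le> n" "n < 244"
  shows "realizable n (bound n) n"
proof -
  obtain q where q: "n = 2 * q" using assms by blast
  consider "26 \<le> n" "n \<le> 38" | "40 \<le> n" "n \<le> 94" | "96 \<le> n"
    using assms q by force
  then show ?thesis
  proof cases
    case 1
    show ?thesis
      by (rule realizable_bound_range[OF realizable_13_12, of n "q - 7" 6 12])
        (use 1 q in \<open>(linarith | simp add: choose_two)+\<close>)
  next
    case 2
    show ?thesis
      by (rule realizable_bound_range[OF realizable_19_37, of n "q - 10" 10 37])
        (use 2 q in \<open>(linarith | simp add: choose_two)+\<close>)
  next
    case 3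
    show ?thesis
      by (rule realizable_bound_range[OF realizable_45, of n "q - 23" 25 98])
        (use 3 q assms in \<open>(linarith | simp add: choose_two)+\<close>)
  qed
qed

text \<open>Now the bases are even: 20, 32 and 36. Each range ends where \<open>g\<close> reaches
  the content range 20, 28 or 103 of its base, the last at \<open>n = 243\<close>.\<close>

lemma realizable_odd:
  assumes "odd n" "37 \<le> n" "n < 244"
  shows "realizable n (bound n) n"
proof -
  obtain q where q: "n = 2 * q + 1" using assms by (blast elim: oddE)
  consider "37 \<le> n" "n \<le> 61" | "63 \<le> n" "n \<le> 89" | "91 \<le> n"
    using assms q by force
  then show ?thesis
  proof cases
    case 1
    show ?thesis
      by (rule realizable_bound_range[OF realizable_20_20, of n "q - 10" 8 20])
        (use 1 q in \<open>(linarith | simp add: choose_two)+\<close>)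
  next
    case 2
    show ?thesis
      by (rule realizable_bound_range[OF realizable_32, of n "q - 16" 15 28])
        (use 2 q in \<open>(linarith | simp add: choose_two)+\<close>)
  next
    case 3
    show ?thesis
      by (rule realizable_bound_range[OF realizable_36, of n "q - 18" 27 103])
        (use 3 q assms in \<open>(linarith | simp add: choose_two)+\<close>)
  qed
qed

section \<open>Induction over all sizes\<close>

lemma realizable_bound: "n \<ge> 15 \<Longrightarrow> realizable n (bound n) n"
proof (induction n rule: less_induct)
  case (less n)
  show ?case
  proof (cases "n < 244")
    case True
    then show ?thesis
      using less.prems realizable_small[of n] realizable_even[of n] realizable_odd[of n]
      by (cases "n < 26"; cases "n < 36"; cases "n = 36") auto
  next
    case False
    \<comment> \<open>The hook takes about 3n/4 boxes and leaves s \<approx> n/4. Its range, about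
      3n^2/32, exceeds \<open>bound n\<close>, about n^2/18, while \<open>bound s\<close>, about
      n^2/288, exceeds \<open>g\<close> for large n.\<close>
    define g where "g = 3 * n div 8"
    define s where "s = n - 2 * g - 1"
    have g: "3 * int n - 7 \<le> 8 * int g" "8 * int g \<le> 3 * int n"
      unfolding g_def by linarith+
    have s: "int s = int n - 2 * int g - 1" using g False unfolding s_def by linarith
    have s4: "int n - 4 \<le> 4 * int s" "4 * int s \<le> int n + 3" using s g by linarith+
    \<comment> \<open>Inner arms and legs are bounded only by the size \<open>s\<close>, hence the
      factor \<open>g - s\<close> below.\<close>
    have IH: "realizable s (bound s) s"
      using less.IH[of s] s4 False by linarith
    have "18 * 16 * int g \<le> (int n - 72) * (int n - 84)"
    proof -
      \<comment> \<open>The threshold 244 comes from here: (n - 72)(n - 84) - 108n = (n - 244)(n -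
        20) + 1168.\<close>
      have "0 \<le> (int n - 244) * (int n - 20)" using False by simp
      then have "108 * int n \<le> (int n - 72) * (int n - 84)"
        using False by (simp add: algebra_simps)
      then show ?thesis using g by linarith
    qed
    also have "\<dots> \<le> (4 * int s - 68) * (4 * int s - 80)"
      using s4 False by (intro mult_mono) auto
    also have "\<dots> = 16 * ((int s - 17) * (int s - 20))" by (simp add: algebra_simps)
    also have "\<dots> \<le> 16 * (18 * int (bound s))"
      using bound_lower[of s] s4 False by linarith
    finally have gR: "g \<le> bound s" by simp
    \<comment> \<open>Rounding leaves 4(2g + 1) \<ge> 3n - 3 and 8(g - s) \<ge> n - 13. After
      scaling by 288 the leading coefficients to compare are 16 and 27.\<close>
    have "16 * (18 * int (bound n)) \<le> 16 * ((int n - 15) * (int n - 18))"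
      using bound_upper[of n] False by linarith
    also have "\<dots> \<le> 27 * ((int n - 1) * (int n - 13))"
    proof -
      have "244 * 244 \<le> int n * int n" using False by (intro mult_mono) auto
      then show ?thesis by (simp add: algebra_simps)
    qed
    also have "\<dots> = 9 * ((3 * int n - 3) * (int n - 13))" by (simp add: algebra_simps)
    also have "\<dots> \<le> 9 * ((4 * (2 * int g + 1)) * (8 * (int g - int s)))"
      using g s4 s False by (intro mult_left_mono mult_mono) auto
    also have "\<dots> = 288 * ((2 * int g + 1) * (int g - int s))" by (simp add: algebra_simps)
    finally have "int (bound n) \<le> (2 * int g + 1) * (int g - int s)" by simp
    moreover have gs: "s \<le> g" using s s4 g False by linarith
    ultimately have "int (bound n) \<le> int ((2 * g + 1) * (g - s))"
      by (simp only: of_nat_mult of_nat_diff of_nat_add of_nat_numeral of_nat_1)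
    then have "bound n \<le> (2 * g + 1) * (g - s) + g" by linarith
    moreover have "n = s + 2 * g + 1" using s by linarith
    ultimately show ?thesis by (rule realizable_add_hook_max[OF IH gR gs, rotated])
  qed
qed

theorem theorem3p3:
  fixes n :: nat and k :: int and vs :: "(nat \<Rightarrow> nat) list"
  assumes "n \<ge> 15"
    and "k \<in> {- int (((n - 15) div 3) choose 2) .. int (((n - 15) div 3) choose 2)}"
    and "distinct vs"
    and "set vs = pverts (cayley_graph (sym_group n) (transpositions n))"
  shows "eigenvalue
           (adjacency_mat (cayley_graph (sym_group n) (transpositions n)) vs) (of_int k)"
proof -
  have "\<bar>k\<bar> \<le> int (bound n)" using assms(2) by auto
  then obtain xs where xs: "frobenius n n xs" "frobenius_size xs = n" "frobenius_content xs = k"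
    using realizable_bound[OF assms(1)] unfolding realizable_def by blast
  show ?thesis
    using content_eigenvalue[OF young_diagram_frobenius[OF xs(1)] _ assms(3,4)]
    by (simp add: card_frobenius_diagram content_frobenius_diagram xs)
qed

end
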